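(* Let Assumptions (A1)-(A4) of the context hold and let $\{x_k\}$ be generated by Algorithm 1 (described in the context). Suppose that the singular values of $\nabla c_kA_k$ are greater than some $\delta>0$ for all $k\ge0$. Then for any $\epsilon\in(0,1)$, Algorithm 1 reaches an $\epsilon$-KKT point of the problem $\min_x f(x)$ s.t. $c(x)=0$ within $K$ iterations (i.e. some $x_k$ with $0\le k<K$ is an $\epsilon$-KKT point), where $$K=2(1-\tau)^{-1}\left(\frac{f_0-f_{\rm low}+\rho_{\rm max}C}{\eta_{\rm min}\cdot\min\{\delta^2,1\}}\right)\epsilon^{-2},$$ $$\rho_{\rm max}=\max\left\{\frac{L_c^2C\bar\beta^2+L_fL_c\bar\beta}{\beta},\rho_0\right\},\qquad \eta_{\rm min}=\min\left\{\frac{\tau}{L_g^f+\rho_{\rm max}L_g^c},\frac{1}{L_c^2\bar\beta}\right\}.$$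
   Context: Problem: $\min_{x\in\mathbb{R}^d} f(x)$ subject to $c(x)=0$, with $f:\mathbb{R}^d\to\mathbb{R}$, $c=(c_1,\dots,c_m)^\top:\mathbb{R}^d\to\mathbb{R}^m$. Here $\nabla c(x)\in\mathbb{R}^{d\times m}$ has columns $\nabla c_i(x)$; $\|\cdot\|$ is the Euclidean norm (operator norm for matrices); a subscript $k$ means evaluation at $x_k$ (e.g. $f_k=f(x_k)$, $c_k=c(x_k)$, $A_k=A(x_k)$). A point $x$ is an $\epsilon$-KKT point if there is $\lambda\in\mathbb{R}^m$ with $\|\nabla f(x)+\nabla c(x)\lambda\|\le\epsilon$ and $\|c(x)\|\le\epsilon$. Algorithm 1. Inputs: $x_0\in\mathbb{R}^d$, $\tau\in(0,1)$, $\rho_0>0$, a mapping $A:\mathbb{R}^d\to\mathbb{R}^{m\times m}$, and the constants $\beta,L_g^f,L_g^c$ below. For $k=0,1,2,\dots$: (1) $s_k=-\mathrm{P}_{V_k}\nabla f_k-\nabla c_kA_kc_k$, where $\mathrm{P}_{V_k}$ is the orthogonal projection onto $V_k=\{v:\nabla c_k^\top v=0\}$, i.e. $\mathrm{P}_{V_k}\nabla f_k=\nabla f_k-\nabla c_k(\nabla c_k^\top\nabla c_k)^{-1}\nabla c_k^\top\nabla f_k$. If $s_k=0$, return $x_k$. (2) $\rho_k=\max\left\{\frac{\nabla f_k^\top s_k+\frac12\|s_k\|^2}{\beta\|c_k\|},\rho_{k-1}\right\}$ if $c_k\ne0$, and $\rho_k=\rho_{k-1}$ if $c_k=0$ (at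 $k=0$, $\rho_{k-1}$ means the input value $\rho_0$). (3) $\eta_k=\min\left\{\frac{\tau}{L_g^f+\rho_kL_g^c},\frac{1}{\|\nabla c_k^\top\nabla c_kA_k\|}\right\}$ and $x_{k+1}=x_k+\eta_ks_k$. In $\rho_{\rm max}$, $\rho_0$ is the input value. Statements over all $k$ are understood with the recursion continued (so $x_{k+1}=x_k$) if $s_k=0$ occurs. Assumptions. (A1) $\mathcal X$ is an open convex set containing $\{x_k\}$; $f$ is level bounded and bounded below by $f_{\rm low}$; there is $C>0$ with $\|c(x)\|\le C$ for all $x\in\mathcal X$. (A2) $f$ and all $c_i$ are continuously differentiable, and there are positive constants $L_f,L_g^f,L_c,L_g^c$ such that for all $x,y\in\mathcal X$: $\|\nabla f(x)\|\le L_f$, $\|\nabla f(x)-\nabla f(y)\|\le L_g^f\|x-y\|$, $\|\nabla c(x)\|\le L_c$, $\|\nabla c(x)-\nabla c(y)\|\le L_g^c\|x-y\|$. (A3) (Strong LICQ) There is $\nu>0$ such that for all $x\in\mathcal X$ the singular values of $\nabla c(x)$ are bounded below by $\nu$. (A4) For all $x\in\mathcal X$ the matrix $\nabla c(x)^\top\nabla c(x)A(x)$ is symmetric, and there are $\beta,\bar\beta>0$ with $\lambda_{\min}(\nabla c(x)^\top\nabla c(x)A(x))\ge\beta$ and $\|A(x)\|\le\bar\beta$ for all $x\in\mathcal X$. *)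

theory Defs
  imports "HOL-Analysis.Analysis"
begin

definition gradient :: "('a::real_inner \<Rightarrow> real) \<Rightarrow> 'a \<Rightarrow> 'a" where
  "gradient f x = (THE g. GDERIV f x :> g)"

lemma GDERIV_gradient:
  fixes f :: "'a::euclidean_space \<Rightarrow> real"
  assumes "f differentiable (at x)"
  shows "GDERIV f x :> gradient f x"
proof -
  obtain f' where f': "(f has_derivative f') (at x)"
    using assms by (auto simp: differentiable_def)
  then interpret bounded_linear f' by (rule has_derivative_bounded_linear)
  define g where "g = (\<Sum>b\<in>Basis. f' b *\<^sub>R b)"
  have "h \<bullet> g = f' h" for h
  proof -
    have "f' h = f' (\<Sum>b\<in>Basis. (h \<bullet> b) *\<^sub>R b)"
      by (simp add: euclidean_representation)
    also have "\<dots> = h \<bullet> g"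
      by (simp add: sum scaleR g_def inner_sum_right mult.commute)
    finally show ?thesis by simp
  qed
  then have g: "GDERIV f x :> g"
    using f' by (simp add: gderiv_def)
  have "g' = g" if "GDERIV f x :> g'" for g'
  proof -
    have "(\<lambda>h. h \<bullet> g') = (\<lambda>h. h \<bullet> g)"
      using that g has_derivative_unique unfolding gderiv_def by blast
    then have "h \<bullet> g' = h \<bullet> g" for h by meson
    then show ?thesis by (metis vector_eq_ldot)
  qed
  with g show ?thesis
    unfolding gradient_def by (rule theI)
qed

definition C1_fun :: "('a::euclidean_space \<Rightarrow> real) \<Rightarrow> bool" where
  "C1_fun f \<longleftrightarrow> (\<forall>x. f differentiable (at x)) \<and> continuous_on UNIV (gradient f)"

text \<open>The transposed Jacobian, a \<open>d \<times> m\<close> matrix whose \<open>j\<close>-th column is the gradient of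
  the \<open>j\<close>-th component.\<close>

definition nabla :: "(real^'d \<Rightarrow> real^'m) \<Rightarrow> real^'d \<Rightarrow> real^'m^'d" where
  "nabla c x = (\<chi> i j. gradient (\<lambda>y. c y $ j) x $ i)"

text \<open>The type-class norm on matrices is the Frobenius norm, hence a separate operator norm.\<close>

definition opnorm :: "real^'n^'m \<Rightarrow> real" where
  "opnorm M = onorm (\<lambda>v. M *v v)"

definition eigenvalues :: "real^'n^'n \<Rightarrow> real set" where
  "eigenvalues M = {e. \<exists>v. v \<noteq> 0 \<and> M *v v = e *\<^sub>R v}"

text \<open>Only used for symmetric matrices, whose set of real eigenvalues is finite and nonempty.\<close>

definition lambda_min :: "real^'n^'n \<Rightarrow> real" where
  "lambda_min M = Min (eigenvalues M)"

text \<open>For a \<open>d \<times> m\<close> matrix these are the \<open>m\<close> singular values (up to multiplicity); a lower bound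
  \<open>\<nu> > 0\<close> on them therefore amounts to linear independence of the columns with constant \<open>\<nu>\<close>, and
  in particular forces \<open>m \<le> d\<close>.\<close>

definition singular_values :: "real^'m^'d \<Rightarrow> real set" where
  "singular_values M = sqrt ` eigenvalues (transpose M ** M)"

definition orth_proj :: "'a::euclidean_space set \<Rightarrow> 'a \<Rightarrow> 'a" where
  "orth_proj V u = closest_point V u"

lemma orth_proj_kernel_transpose:
  fixes N :: "real^'m^'d"
  assumes "invertible (transpose N ** N)"
  shows "orth_proj {v. transpose N *v v = 0} u
    = u - (N ** matrix_inv (transpose N ** N) ** transpose N) *v u"
proof -
  let ?V = "{v. transpose N *v v = 0}"
  let ?G = "transpose N ** N"
  define w where "w = matrix_inv ?G *v (transpose N *v u)"
  define p where "p = u - N *v w"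
  have "?G ** matrix_inv ?G = mat 1"
    using assms unfolding invertible_def matrix_inv_def by (rule someI2_ex) blast
  then have "?G *v w = transpose N *v u"
    by (metis w_def matrix_vector_mul_assoc matrix_vector_mul_lid)
  then have pV: "p \<in> ?V"
    by (simp add: p_def matrix_vector_mult_diff_distrib matrix_vector_mul_assoc
        del: transpose_matrix_vector)
  have sub: "subspace ?V"
    by (intro linear_subspace_kernel matrix_vector_mul_linear)
  have "dist u p \<le> dist u z" if "z \<in> ?V" for z
  proof -
    have "transpose N *v (p - z) = 0"
      using pV that by (simp add: matrix_vector_mult_diff_distrib del: transpose_matrix_vector)
    then have "orthogonal (N *v w) (p - z)"
      by (metis dot_lmul_matrix inner_commute inner_zero_right orthogonal_def transpose_matrix_vector)
    then have "(norm (N *v w + (p - z)))\<^sup>2 = (norm (N *v w))\<^sup>2 + (norm (p - z))\<^sup>2"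
      by (rule norm_add_Pythagorean)
    then have "(norm (u - p))\<^sup>2 \<le> (norm (u - z))\<^sup>2"
      by (simp add: p_def)
    then show ?thesis
      by (simp add: dist_norm)
  qed
  then have "p = closest_point ?V u"
    using pV sub closed_subspace subspace_imp_convex by (intro closest_point_unique) auto
  then show ?thesis
    by (simp add: orth_proj_def p_def w_def matrix_vector_mul_assoc matrix_mul_assoc
        del: transpose_matrix_vector)
qed

definition eps_KKT ::
  "real \<Rightarrow> (real^'d \<Rightarrow> real) \<Rightarrow> (real^'d \<Rightarrow> real^'m) \<Rightarrow> real^'d \<Rightarrow> bool" where
  "eps_KKT \<epsilon> f c x \<longleftrightarrow>
     (\<exists>\<mu>::real^'m. norm (gradient f x + nabla c x *v \<mu>) \<le> \<epsilon>) \<and> norm (c x) \<le> \<epsilon>"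

text \<open>The iterates \<open>x\<close>, directions \<open>s\<close>, penalty parameters \<open>\<rho>\<close> and step sizes \<open>\<eta>\<close> produced from
  the inputs \<open>x\<^sub>0\<close>, \<open>\<tau>\<close>, \<open>\<rho>\<^sub>0\<close>, \<open>A\<close> and the constants \<open>\<beta>\<close>, \<open>Lgf\<close>, \<open>Lgc\<close>. Returning \<open>x\<^sub>k\<close> when
  \<open>s\<^sub>k = 0\<close> is modelled by continuing the recursion, which then stays at \<open>x\<^sub>k\<close>.\<close>

definition algorithm1 ::
  "(real^'d \<Rightarrow> real) \<Rightarrow> (real^'d \<Rightarrow> real^'m) \<Rightarrow> (real^'d \<Rightarrow> real^'m^'m) \<Rightarrow>
   real^'d \<Rightarrow> real \<Rightarrow> real \<Rightarrow> real \<Rightarrow> real \<Rightarrow> real \<Rightarrow>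
   (nat \<Rightarrow> real^'d) \<Rightarrow> (nat \<Rightarrow> real^'d) \<Rightarrow> (nat \<Rightarrow> real) \<Rightarrow> (nat \<Rightarrow> real) \<Rightarrow> bool" where
  "algorithm1 f c A x0 \<tau> \<rho>0 \<beta> Lgf Lgc x s \<rho> \<eta> \<longleftrightarrow>
     x 0 = x0 \<and>
     (\<forall>k. let g = gradient f (x k); N = nabla c (x k); ck = c (x k); Ak = A (x k);
              \<rho>prev = (if k = 0 then \<rho>0 else \<rho> (k - 1))
          in s k = - orth_proj {v. transpose N *v v = 0} g - N *v (Ak *v ck) \<and>
             \<rho> k = (if ck \<noteq> 0
                     then max ((g \<bullet> s k + (1/2) * (norm (s k))\<^sup>2) / (\<beta> * norm ck)) \<rho>prev
                     else \<rho>prev) \<and>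
             \<eta> k = min (\<tau> / (Lgf + \<rho> k * Lgc)) (1 / opnorm (transpose N ** N ** Ak)) \<and>
             x (Suc k) = x k + \<eta> k *\<^sub>R s k)"

end

theory Submission
  imports Defs
begin

text \<open>The proof follows the penalty function \<open>f + \<rho> \<parallel>c\<parallel>\<close> along the iterates. A step
  \<open>s = - p - N A c\<close> (with \<open>N = \<nabla>c\<close> and \<open>p\<close> the projection of \<open>g = \<nabla>f\<close> onto the kernel of
  \<open>N\<^sup>T\<close>) consists of two orthogonal parts. The tangential part \<open>p\<close> does not change the linearised
  constraint; the normal part multiplies the constraint value, to first order, by \<open>I - \<eta> M\<close> with
  the symmetric matrix \<open>M = N\<^sup>T N A\<close>, whose eigenvalues are at least \<open>\<beta>\<close>. Because
  \<open>\<eta> \<le> 1 / \<parallel>M\<parallel>\<close>, this is a contraction with factor \<open>1 - \<eta> \<beta>\<close>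
  (\<open>norm_symmetric_step_le\<close>). The rule for \<open>\<rho>\<close> ensures that this first-order gain in
  \<open>\<rho> \<parallel>c\<parallel>\<close> pays for a possible increase of \<open>f\<close> and leaves a decrease of \<open>\<eta> \<parallel>s\<parallel>\<^sup>2 / 2\<close>; the
  second-order errors of \<open>f\<close> and \<open>c\<close> (\<open>linearisation_error_le\<close>) consume at most the fraction
  \<open>\<tau>\<close> of it, because \<open>\<eta> \<le> \<tau> / (L\<^sub>f + \<rho> L\<^sub>c)\<close>, where \<open>L\<^sub>f\<close> and \<open>L\<^sub>c\<close> denote the
  Lipschitz constants of the two derivatives (\<open>merit_decrease\<close>).

  The penalty parameters never decrease but stay below \<open>\<rho>\<^sub>m\<^sub>a\<^sub>x\<close>, because the quotient in their rule is
  bounded: the numerator contains \<open>- \<parallel>p\<parallel>\<^sup>2 / 2 \<le> 0\<close> and otherwise only terms of size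
  \<open>O(\<parallel>c\<parallel>)\<close>. Hence the step sizes stay above \<open>\<eta>\<^sub>m\<^sub>i\<^sub>n\<close>, and all decreases together amount to at
  most \<open>f x\<^sub>0 - f\<^sub>l\<^sub>o\<^sub>w + \<rho>\<^sub>m\<^sub>a\<^sub>x C\<close> (\<open>sum_merit_decreases_le\<close>).

  Finally \<open>\<parallel>s\<parallel>\<^sup>2 = \<parallel>p\<parallel>\<^sup>2 + \<parallel>N A c\<parallel>\<^sup>2 \<ge> min (\<delta>\<^sup>2) 1 (\<parallel>p\<parallel>\<^sup>2 + \<parallel>c\<parallel>\<^sup>2)\<close>, and \<open>p = g + N \<mu>\<close> for
  some multiplier \<open>\<mu>\<close>. At an iterate that is not an \<open>\<epsilon>\<close>-KKT point this exceeds
  \<open>min (\<delta>\<^sup>2) 1 \<epsilon>\<^sup>2\<close>, so each such iterate uses up a fixed amount of the bounded total, and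
  the iterates with index below \<open>K\<close> cannot all be of this kind.\<close>

section \<open>Symmetric operators and their quadratic forms\<close>

text \<open>The discriminant of the nonnegative polynomial \<open>t \<mapsto> (u + t v) \<bullet> T (u + t v)\<close> cannot be
  positive. Applied to the pair \<open>v, T v\<close>, this inequality turns information on the quadratic form of
  \<open>T\<close> into information on the vectors \<open>T v\<close>, which is its use in the two lemmas that follow it.\<close>

lemma psd_Cauchy_Schwarz:
  fixes T :: "'a::real_inner \<Rightarrow> 'a"
  assumes "linear T" and sym: "\<And>u v. u \<bullet> T v = T u \<bullet> v" and psd: "\<And>v. 0 \<le> v \<bullet> T v"
  shows "(u \<bullet> T v)\<^sup>2 \<le> (u \<bullet> T u) * (v \<bullet> T v)"
proof -
  interpret T: linear T by fact
  let ?a = "u \<bullet> T u" and ?b = "u \<bullet> T v" and ?d = "v \<bullet> T v"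
  have vu: "v \<bullet> T u = ?b"
    using sym[of v u] by (simp add: inner_commute)
  have poly: "0 \<le> ?a + 2 * t * ?b + t\<^sup>2 * ?d" for t
  proof -
    have "(u + t *\<^sub>R v) \<bullet> T (u + t *\<^sub>R v) = ?a + 2 * t * ?b + t\<^sup>2 * ?d"
      unfolding T.add T.scaleR inner_add_left inner_add_right inner_scaleR_left inner_scaleR_right vu
      by (simp add: power2_eq_square algebra_simps)
    with psd[of "u + t *\<^sub>R v"] show ?thesis by simp
  qed
  show ?thesis
  proof (cases "?d = 0")
    case True
    have "?b = 0"
    proof (rule ccontr)
      assume "?b \<noteq> 0"
      with poly[of "- (?a + 1) / (2 * ?b)"] True show False by (simp add: field_simps)
    qed
    with True show ?thesis by simp
  next
    case False
    with psd[of v] have d: "0 < ?d" by simp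
    have "0 \<le> ?a - ?b\<^sup>2 / ?d"
      using poly[of "- ?b / ?d"] d by (simp add: power2_eq_square field_simps)
    with d show ?thesis by (simp add: field_simps)
  qed
qed

lemma norm_psd_le:
  fixes T :: "'a::real_inner \<Rightarrow> 'a"
  assumes "linear T" "\<And>u v. u \<bullet> T v = T u \<bullet> v" "\<And>v. 0 \<le> v \<bullet> T v"
    and le: "\<And>v. v \<bullet> T v \<le> b * (norm v)\<^sup>2"
  shows "norm (T v) \<le> b * norm v"
proof (cases "v = 0 \<or> T v = 0")
  case True
  have "0 \<le> b \<or> v = 0"
    using assms(3)[of v] le[of v] by (auto simp: zero_le_mult_iff dest: order_trans)
  with True show ?thesis
    using assms(1) by (auto simp: linear_0)
next
  case False
  then have pos: "0 < norm (T v)" "0 < norm v" by auto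
  have "0 \<le> b * (norm v)\<^sup>2"
    using assms(3)[of v] le[of v] by linarith
  then have b: "0 \<le> b"
    using pos by (simp add: zero_le_mult_iff)
  have "((norm (T v))\<^sup>2)\<^sup>2 = (T v \<bullet> T v)\<^sup>2"
    by (simp add: power2_norm_eq_inner)
  also have "\<dots> \<le> (T v \<bullet> T (T v)) * (v \<bullet> T v)"
    by (rule psd_Cauchy_Schwarz) (use assms in auto)
  also have "\<dots> \<le> (b * (norm (T v))\<^sup>2) * (b * (norm v)\<^sup>2)"
    using assms(3) le b by (intro mult_mono) auto
  finally have "(norm (T v))\<^sup>2 * (norm (T v))\<^sup>2 \<le> (b * norm v)\<^sup>2 * (norm (T v))\<^sup>2"
    by (simp add: power2_eq_square algebra_simps)
  then have "(norm (T v))\<^sup>2 \<le> (b * norm v)\<^sup>2"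
    by (rule mult_right_le_imp_le) (use pos in simp)
  then show ?thesis
    by (rule power2_le_imp_le) (use b in simp)
qed

text \<open>The minimiser of the Rayleigh quotient exists because the unit sphere is compact. It is an
  eigenvector: the form of \<open>T - \<mu> I\<close> is nonnegative and vanishes at the minimiser, hence so does
  \<open>T - \<mu> I\<close> itself by the Cauchy--Schwarz inequality.\<close>

lemma Rayleigh_minimal_eigenvector:
  fixes T :: "'a::euclidean_space \<Rightarrow> 'a"
  assumes "linear T" and sym: "\<And>u v. u \<bullet> T v = T u \<bullet> v"
  obtains w \<mu> where "norm w = 1" "T w = \<mu> *\<^sub>R w" "\<And>v. \<mu> * (norm v)\<^sup>2 \<le> v \<bullet> T v"
proof -
  interpret T: linear T by fact
  have "continuous_on (sphere 0 1) (\<lambda>v. v \<bullet> T v)"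
    by (intro continuous_intros linear_continuous_on linear_conv_bounded_linear[THEN iffD1] assms(1))
  then obtain w where w: "norm w = 1" and min: "\<And>v. norm v = 1 \<Longrightarrow> w \<bullet> T w \<le> v \<bullet> T v"
    using continuous_attains_inf[of "sphere (0::'a) 1" "\<lambda>v. v \<bullet> T v"] by auto
  define \<mu> where "\<mu> = w \<bullet> T w"
  have form: "\<mu> * (norm v)\<^sup>2 \<le> v \<bullet> T v" for v
  proof (cases "v = 0")
    case False
    have "\<mu> \<le> (v /\<^sub>R norm v) \<bullet> T (v /\<^sub>R norm v)"
      unfolding \<mu>_def by (rule min) (use False in simp)
    also have "\<dots> = (v \<bullet> T v) / (norm v)\<^sup>2"
      by (simp add: T.scaleR power2_eq_square divide_simps)
    finally show ?thesis
      using False by (simp add: field_simps)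
  qed simp
  define S where "S v = T v - \<mu> *\<^sub>R v" for v
  have "(S w \<bullet> S w)\<^sup>2 \<le> (S w \<bullet> S (S w)) * (w \<bullet> S w)"
  proof (rule psd_Cauchy_Schwarz)
    show "linear S"
      by (rule linearI) (simp_all add: S_def T.add T.scaleR algebra_simps)
    show "u \<bullet> S v = S u \<bullet> v" for u v
      by (simp add: S_def sym inner_diff_left inner_diff_right)
    show "0 \<le> v \<bullet> S v" for v
      using form[of v] by (simp add: S_def inner_diff_right power2_norm_eq_inner)
  qed
  moreover have "w \<bullet> S w = 0"
    using w by (simp add: S_def inner_diff_right \<mu>_def power2_norm_eq_inner[symmetric])
  ultimately have "S w = 0" by simp
  then have "T w = \<mu> *\<^sub>R w" by (simp add: S_def)
  with w form show thesis by (intro that)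
qed

section \<open>Eigenvalues, singular values and operator norms of matrices\<close>

lemma inner_transpose_matrix_vector:
  fixes M :: "real^'n^'m"
  shows "(transpose M *v u) \<bullet> v = u \<bullet> (M *v v)"
  by (simp add: dot_lmul_matrix)

lemma symmetric_matrix_inner:
  fixes M :: "real^'n^'n"
  assumes "transpose M = M"
  shows "u \<bullet> (M *v v) = (M *v u) \<bullet> v"
  using inner_transpose_matrix_vector[of M u v] assms by simp

lemma symmetric_matrix_form_ge:
  fixes M :: "real^'n^'n"
  assumes "transpose M = M" and "\<And>e. e \<in> eigenvalues M \<Longrightarrow> b \<le> e"
  shows "b * (norm v)\<^sup>2 \<le> v \<bullet> (M *v v)"
proof -
  obtain w \<mu> where w: "norm w = 1" "M *v w = \<mu> *\<^sub>R w" and form: "\<And>v. \<mu> * (norm v)\<^sup>2 \<le> v \<bullet> (M *v v)"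
    using Rayleigh_minimal_eigenvector[of "(*v) M"] symmetric_matrix_inner[OF assms(1)] by auto
  have "w \<noteq> 0" using w(1) by auto
  then have "\<mu> \<in> eigenvalues M"
    using w(2) by (auto simp: eigenvalues_def)
  then have "b * (norm v)\<^sup>2 \<le> \<mu> * (norm v)\<^sup>2"
    by (intro mult_right_mono assms) auto
  with form[of v] show ?thesis by linarith
qed

text \<open>Eigenvectors of a symmetric matrix for different eigenvalues are orthogonal, hence linearly
  independent. Finiteness is what makes the minimum in \<^const>\<open>lambda_min\<close> a lower bound.\<close>

lemma finite_eigenvalues_symmetric:
  fixes M :: "real^'n^'n"
  assumes "transpose M = M"
  shows "finite (eigenvalues M)"
proof -
  have "\<forall>e\<in>eigenvalues M. \<exists>v. v \<noteq> 0 \<and> M *v v = e *\<^sub>R v"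
    by (simp add: eigenvalues_def)
  from bchoice[OF this] obtain v
    where v: "\<And>e. e \<in> eigenvalues M \<Longrightarrow> v e \<noteq> 0 \<and> M *v v e = e *\<^sub>R v e" by blast
  have orth: "orthogonal (v d) (v e)" if "d \<in> eigenvalues M" "e \<in> eigenvalues M" "d \<noteq> e" for d e
  proof -
    have "v d \<bullet> (M *v v e) = (M *v v d) \<bullet> v e"
      by (rule symmetric_matrix_inner[OF assms])
    then have "e * (v d \<bullet> v e) = d * (v d \<bullet> v e)"
      using v[OF that(1)] v[OF that(2)] by simp
    with that show ?thesis by (simp add: orthogonal_def)
  qed
  have inj: "inj_on v (eigenvalues M)"
    by (rule inj_onI) (metis orth orthogonal_self v)
  have "pairwise orthogonal (v ` eigenvalues M)"
    using orth by (auto simp: pairwise_def)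
  moreover have "0 \<notin> v ` eigenvalues M"
    using v by force
  ultimately have "finite (v ` eigenvalues M)"
    by (intro independent_imp_finite pairwise_orthogonal_independent)
  with inj show ?thesis
    by (simp add: finite_image_iff)
qed

lemma lambda_min_form_le:
  fixes M :: "real^'n^'n"
  assumes "transpose M = M"
  shows "lambda_min M * (norm v)\<^sup>2 \<le> v \<bullet> (M *v v)"
  using finite_eigenvalues_symmetric[OF assms]
  by (intro symmetric_matrix_form_ge assms) (simp add: lambda_min_def)

lemma norm_ge_singular_value_bound:
  fixes M :: "real^'m^'d"
  assumes "0 \<le> b" and "\<And>\<sigma>. \<sigma> \<in> singular_values M \<Longrightarrow> b \<le> \<sigma>"
  shows "b * norm v \<le> norm (M *v v)"
proof -
  let ?G = "transpose M ** M"
  have "b\<^sup>2 * (norm v)\<^sup>2 \<le> v \<bullet> (?G *v v)"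
  proof (rule symmetric_matrix_form_ge)
    show "transpose ?G = ?G"
      by (simp add: matrix_transpose_mul)
    fix e assume e: "e \<in> eigenvalues ?G"
    then obtain u where u: "u \<noteq> 0" "?G *v u = e *\<^sub>R u"
      by (auto simp: eigenvalues_def)
    have "(M *v u) \<bullet> (M *v u) = e * (u \<bullet> u)"
      using u(2) inner_transpose_matrix_vector[of M "M *v u" u]
      by (simp add: matrix_vector_mul_assoc del: transpose_matrix_vector)
    moreover have "0 \<le> (M *v u) \<bullet> (M *v u)" "0 < u \<bullet> u"
      using u(1) by auto
    ultimately have "0 \<le> e"
      by (simp add: zero_le_mult_iff)
    moreover have "b \<le> sqrt e"
      using e assms(2) by (auto simp: singular_values_def)
    ultimately show "b\<^sup>2 \<le> e"
      using \<open>0 \<le> b\<close> by (metis power_mono real_sqrt_pow2)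
  qed
  also have "\<dots> = (norm (M *v v))\<^sup>2"
    using inner_transpose_matrix_vector[of M "M *v v" v]
    by (simp add: power2_norm_eq_inner matrix_vector_mul_assoc inner_commute
        del: transpose_matrix_vector)
  finally have "(b * norm v)\<^sup>2 \<le> (norm (M *v v))\<^sup>2"
    by (simp add: power_mult_distrib)
  then show ?thesis
    by (rule power2_le_imp_le) simp
qed

lemma invertible_Gram_matrix:
  fixes M :: "real^'m^'d"
  assumes "0 < b" and "\<And>\<sigma>. \<sigma> \<in> singular_values M \<Longrightarrow> b \<le> \<sigma>"
  shows "invertible (transpose M ** M)"
proof -
  have "v = 0" if "(transpose M ** M) *v v = 0" for v
  proof -
    have "(M *v v) \<bullet> (M *v v) = 0"
      using that inner_transpose_matrix_vector[of M "M *v v" v]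
      by (simp add: matrix_vector_mul_assoc del: transpose_matrix_vector)
    then have "b * norm v \<le> 0"
      using norm_ge_singular_value_bound[of b M v] assms by simp
    with \<open>0 < b\<close> show ?thesis by (simp add: mult_le_0_iff)
  qed
  then show ?thesis
    by (metis invertible_left_inverse matrix_left_invertible_ker)
qed

lemma norm_matrix_vector_le:
  fixes M :: "real^'n^'m"
  shows "norm (M *v v) \<le> opnorm M * norm v"
  unfolding opnorm_def by (rule onorm) (rule matrix_vector_mul_bounded_linear)

lemma opnorm_nonneg: "0 \<le> opnorm (M :: real^'n^'m)"
  unfolding opnorm_def by (rule onorm_pos_le) (rule matrix_vector_mul_bounded_linear)

lemma opnorm_le:
  fixes M :: "real^'n^'m"
  assumes "\<And>v. norm (M *v v) \<le> b * norm v"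
  shows "opnorm M \<le> b"
  unfolding opnorm_def by (rule onorm_le) (rule assms)

lemma opnorm_mult_le:
  fixes M :: "real^'n^'m" and N :: "real^'k^'n"
  shows "opnorm (M ** N) \<le> opnorm M * opnorm N"
proof (rule opnorm_le)
  fix v :: "real^'k"
  have "norm (M *v (N *v v)) \<le> opnorm M * norm (N *v v)"
    by (rule norm_matrix_vector_le)
  also have "\<dots> \<le> opnorm M * (opnorm N * norm v)"
    by (intro mult_left_mono norm_matrix_vector_le opnorm_nonneg)
  finally show "norm ((M ** N) *v v) \<le> opnorm M * opnorm N * norm v"
    by (simp add: matrix_vector_mul_assoc mult.assoc)
qed

lemma opnorm_transpose_le:
  fixes M :: "real^'n^'m"
  shows "opnorm (transpose M) \<le> opnorm M"
proof (rule opnorm_le)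
  fix v :: "real^'m"
  let ?u = "transpose M *v v"
  have "norm ?u * norm ?u = v \<bullet> (M *v ?u)"
    by (metis inner_transpose_matrix_vector power2_eq_square power2_norm_eq_inner)
  also have "\<dots> \<le> norm v * norm (M *v ?u)"
    by (rule norm_cauchy_schwarz)
  also have "\<dots> \<le> norm v * (opnorm M * norm ?u)"
    by (intro mult_left_mono norm_matrix_vector_le norm_ge_zero)
  finally have "norm ?u * norm ?u \<le> (opnorm M * norm v) * norm ?u"
    by (simp add: ac_simps del: transpose_matrix_vector)
  moreover have "0 \<le> opnorm M * norm v"
    by (simp add: opnorm_nonneg)
  ultimately show "norm ?u \<le> opnorm M * norm v"
    by (cases "norm ?u = 0") (auto simp del: transpose_matrix_vector)
qed

lemma norm_transpose_matrix_vector_le: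
  fixes M :: "real^'n^'m"
  shows "norm (transpose M *v v) \<le> opnorm M * norm v"
  using norm_matrix_vector_le[of "transpose M" v] mult_right_mono[OF opnorm_transpose_le[of M], of "norm v"]
  by simp

text \<open>For \<open>0 \<le> \<eta> \<le> 1 / \<parallel>M\<parallel>\<close> the form of \<open>I - \<eta> M\<close> lies between \<open>0\<close> and \<open>1 - \<eta> b\<close>. The upper
  restriction on the step size is what excludes overshooting, that is, negative values of the form.\<close>

lemma norm_symmetric_step_le:
  fixes M :: "real^'n^'n"
  assumes sym: "transpose M = M" and form: "\<And>v. b * (norm v)\<^sup>2 \<le> v \<bullet> (M *v v)"
    and \<eta>: "0 \<le> \<eta>" "\<eta> * opnorm M \<le> 1"
  shows "norm (v - \<eta> *\<^sub>R (M *v v)) \<le> (1 - \<eta> * b) * norm v"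
proof (rule norm_psd_le)
  show "linear (\<lambda>v. v - \<eta> *\<^sub>R (M *v v))"
    by (rule linearI) (simp_all add: algebra_simps matrix_vector_right_distrib matrix_vector_mult_scaleR)
  show "u \<bullet> (v - \<eta> *\<^sub>R (M *v v)) = (u - \<eta> *\<^sub>R (M *v u)) \<bullet> v" for u v
    by (simp add: inner_diff_left inner_diff_right symmetric_matrix_inner[OF sym])
  show "0 \<le> v \<bullet> (v - \<eta> *\<^sub>R (M *v v))" for v
  proof -
    have "v \<bullet> (M *v v) \<le> norm v * (opnorm M * norm v)"
      using norm_cauchy_schwarz[of v "M *v v"] norm_matrix_vector_le[of M v]
      by (meson mult_left_mono norm_ge_zero order_trans)
    then have "\<eta> * (v \<bullet> (M *v v)) \<le> (\<eta> * opnorm M) * (norm v)\<^sup>2"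
      using mult_left_mono[OF _ \<eta>(1)] by (fastforce simp: power2_eq_square ac_simps)
    also have "\<dots> \<le> 1 * (norm v)\<^sup>2"
      by (intro mult_right_mono \<eta>) simp
    finally show ?thesis
      by (simp add: inner_diff_right power2_norm_eq_inner)
  qed
  show "v \<bullet> (v - \<eta> *\<^sub>R (M *v v)) \<le> (1 - \<eta> * b) * (norm v)\<^sup>2" for v
    using mult_left_mono[OF form[of v] \<eta>(1)]
    by (simp add: inner_diff_right power2_norm_eq_inner algebra_simps)
qed

section \<open>Linearisation error of a map with Lipschitz derivative\<close>

text \<open>Along the segment, the derivative of the error at parameter \<open>t\<close> has norm at most
  \<open>L t \<parallel>h\<parallel>\<^sup>2\<close>; integrating this over \<open>[0, 1]\<close> is replaced by the mean value inequality with the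
  comparison function \<open>L \<parallel>h\<parallel>\<^sup>2 t\<^sup>2 / 2\<close>.\<close>

lemma linearisation_error_le:
  fixes F :: "'a::real_normed_vector \<Rightarrow> 'b::real_normed_vector"
  assumes "convex X" "y \<in> X" "y + h \<in> X"
    and der: "\<And>z. z \<in> X \<Longrightarrow> (F has_derivative F' z) (at z)"
    and lip: "\<And>z. z \<in> X \<Longrightarrow> norm (F' z h - F' y h) \<le> L * norm (z - y) * norm h"
  shows "norm (F (y + h) - F y - F' y h) \<le> L / 2 * (norm h)\<^sup>2"
proof -
  define G where "G t = F (y + t *\<^sub>R h) - t *\<^sub>R F' y h" for t :: real
  define \<phi> where "\<phi> t = L * (norm h)\<^sup>2 / 2 * t\<^sup>2" for t :: real
  have seg: "y + t *\<^sub>R h \<in> X" if "0 \<le> t" "t \<le> 1" for t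
  proof -
    have "(1 - t) *\<^sub>R y + t *\<^sub>R (y + h) \<in> X"
      using that assms by (intro convexD) auto
    then show ?thesis by (simp add: algebra_simps)
  qed
  have G: "(G has_vector_derivative F' (y + t *\<^sub>R h) h - F' y h) (at t)" if "0 \<le> t" "t \<le> 1" for t
  proof -
    have D: "(F has_derivative F' (y + t *\<^sub>R h)) (at (y + t *\<^sub>R h))"
      using der seg that by simp
    then interpret bounded_linear "F' (y + t *\<^sub>R h)"
      by (rule has_derivative_bounded_linear)
    have "((\<lambda>t. F (y + t *\<^sub>R h)) has_derivative (\<lambda>r. F' (y + t *\<^sub>R h) (r *\<^sub>R h))) (at t)"
      by (rule has_derivative_compose[where f = "\<lambda>t. y + t *\<^sub>R h" and g = F])
        (auto intro!: derivative_eq_intros D)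
    then show ?thesis
      unfolding G_def has_vector_derivative_def
      by (auto intro!: derivative_eq_intros simp: scaleR algebra_simps)
  qed
  have "norm (G 1 - G 0) \<le> \<phi> 1 - \<phi> 0"
  proof (rule differentiable_bound_general)
    show "continuous_on {0..1} G"
      using G by (intro continuous_at_imp_continuous_on ballI)
        (auto intro: has_vector_derivative_continuous)
    show "continuous_on {0..1} \<phi>"
      unfolding \<phi>_def by (intro continuous_intros)
    fix t :: real assume t: "0 < t" "t < 1"
    then show "(G has_vector_derivative F' (y + t *\<^sub>R h) h - F' y h) (at t)"
      by (intro G) auto
    show "(\<phi> has_vector_derivative L * (norm h)\<^sup>2 * t) (at t)"
      unfolding \<phi>_def has_real_derivative_iff_has_vector_derivative[symmetric]
      by (auto intro!: derivative_eq_intros)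
    show "norm (F' (y + t *\<^sub>R h) h - F' y h) \<le> L * (norm h)\<^sup>2 * t"
      using lip[OF seg[of t]] t by (simp add: power2_eq_square ac_simps)
  qed simp
  then show ?thesis by (simp add: G_def \<phi>_def algebra_simps)
qed

lemma has_derivative_nabla:
  fixes c :: "real^'d \<Rightarrow> real^'m"
  assumes "\<And>j. (\<lambda>y. c y $ j) differentiable (at z)"
  shows "(c has_derivative (\<lambda>h. transpose (nabla c z) *v h)) (at z)"
proof -
  have comp: "(transpose (nabla c z) *v h) $ j = h \<bullet> gradient (\<lambda>y. c y $ j) z" for h j
    by (simp add: matrix_vector_mult_def transpose_def nabla_def inner_vec_def mult.commute
        del: transpose_matrix_vector)
  have "((\<lambda>y. c y $ j) has_derivative (\<lambda>h. (transpose (nabla c z) *v h) $ j)) (at z)" for j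
    using GDERIV_gradient[OF assms[of j]] unfolding gderiv_def comp .
  then show ?thesis
    unfolding has_derivative_componentwise_within[of c]
    by (auto simp: Basis_vec_def inner_axis simp del: transpose_matrix_vector)
qed

section \<open>One step of the method\<close>

lemma kernel_projection_decomposition:
  fixes N :: "real^'m^'d"
  assumes "invertible (transpose N ** N)"
  obtains \<mu> where "orth_proj {v. transpose N *v v = 0} g = g + N *v \<mu>"
    and "transpose N *v (g + N *v \<mu>) = 0"
proof -
  let ?G = "transpose N ** N"
  let ?\<mu> = "- (matrix_inv ?G *v (transpose N *v g))"
  have inv: "?G ** matrix_inv ?G = mat 1"
    using assms unfolding invertible_def matrix_inv_def by (rule someI2_ex) blast
  have neg: "B *v (- u) = - (B *v u)" for B :: "real^'k^'l" and u
    using vec.neg[of B u] .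
  have "orth_proj {v. transpose N *v v = 0} g = g + N *v ?\<mu>"
    unfolding orth_proj_kernel_transpose[OF assms] neg
    by (simp add: matrix_vector_mul_assoc matrix_mul_assoc del: transpose_matrix_vector)
  moreover have "?G *v ?\<mu> = - (transpose N *v g)"
    unfolding neg matrix_vector_mul_assoc matrix_mul_assoc inv by (simp add: matrix_vector_mul_lid)
  then have "transpose N *v (g + N *v ?\<mu>) = 0"
    unfolding matrix_vector_right_distrib by (simp add: matrix_vector_mul_assoc del: transpose_matrix_vector)
  ultimately show thesis by (rule that)
qed

text \<open>The tangential part \<open>p\<close> and the normal part \<open>N w\<close> of a step are orthogonal. Hence \<open>\<parallel>s\<parallel>\<close> controls
  both, the tangential part does not affect the linearised constraint, and along \<open>p\<close> the
  objective decreases at rate \<open>\<parallel>p\<parallel>\<^sup>2\<close> because \<open>g\<close> and \<open>p\<close> differ by a normal vector.\<close>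

lemma tangential_normal_step:
  fixes N :: "real^'m^'d"
  assumes s: "s = - p - N *v w" and p: "p = g + N *v \<mu>" and ker: "transpose N *v p = 0"
  shows "(norm s)\<^sup>2 = (norm p)\<^sup>2 + (norm (N *v w))\<^sup>2"
    and "g \<bullet> s = - (norm p)\<^sup>2 - g \<bullet> (N *v w)"
    and "transpose N *v s = - ((transpose N ** N) *v w)"
proof -
  have orth: "p \<bullet> (N *v v) = 0" for v
    using inner_transpose_matrix_vector[of N p v] unfolding ker by simp
  have "(norm s)\<^sup>2 = (norm (p + N *v w))\<^sup>2"
    unfolding s by (metis minus_add_distrib norm_minus_cancel uminus_add_conv_diff add.commute)
  then show "(norm s)\<^sup>2 = (norm p)\<^sup>2 + (norm (N *v w))\<^sup>2"
    using norm_add_Pythagorean[of p "N *v w"] orth by (simp add: orthogonal_def)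
  have "g = p - N *v \<mu>" by (simp add: p)
  then have "g \<bullet> p = (norm p)\<^sup>2"
    using orth[of \<mu>] by (simp add: inner_diff_left inner_diff_right power2_norm_eq_inner inner_commute)
  then show "g \<bullet> s = - (norm p)\<^sup>2 - g \<bullet> (N *v w)"
    by (simp add: s inner_diff_right)
  have "transpose N *v s = - (transpose N *v p) - transpose N *v (N *v w)"
    unfolding s matrix_vector_mult_diff_distrib using vec.neg[of "transpose N" p] by simp
  then show "transpose N *v s = - ((transpose N ** N) *v w)"
    unfolding ker by (simp add: matrix_vector_mul_assoc del: transpose_matrix_vector)
qed

text \<open>Here \<open>S\<close> stands for \<open>\<parallel>s\<parallel>\<^sup>2\<close> and \<open>gs\<close> for \<open>g \<bullet> s\<close>. The condition on the penalty parameter makes the linear model of the merit function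
  decrease by \<open>\<parallel>s\<parallel>\<^sup>2 / 2\<close> per unit of step size; the step size is so small that the
  quadratic error terms use up at most the fraction \<open>\<tau>\<close> of this gain.\<close>

lemma merit_decrease:
  fixes f1 f0 c1 c0 :: real
  assumes f1: "f1 \<le> f0 + \<eta> * gs + Lf / 2 * (\<eta>\<^sup>2 * S)"
    and c1: "c1 \<le> (1 - \<eta> * \<beta>) * c0 + Lc / 2 * (\<eta>\<^sup>2 * S)"
    and pen: "gs + S / 2 \<le> \<rho> * \<beta> * c0"
    and \<eta>: "0 \<le> \<eta>" "\<eta> * (Lf + \<rho> * Lc) \<le> \<tau>" and "0 \<le> \<rho>" "0 \<le> S"
  shows "f1 + \<rho> * c1 \<le> f0 + \<rho> * c0 - (1 - \<tau>) / 2 * (\<eta> * S)"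
proof -
  have "\<rho> * c1 \<le> \<rho> * ((1 - \<eta> * \<beta>) * c0 + Lc / 2 * (\<eta>\<^sup>2 * S))"
    using c1 \<open>0 \<le> \<rho>\<close> by (rule mult_left_mono)
  moreover have "\<eta> * (gs + S / 2) \<le> \<eta> * (\<rho> * \<beta> * c0)"
    using pen \<eta>(1) by (rule mult_left_mono)
  moreover have "\<eta> * (Lf + \<rho> * Lc) * (\<eta> * S / 2) \<le> \<tau> * (\<eta> * S / 2)"
    using \<eta> \<open>0 \<le> S\<close> by (intro mult_right_mono) auto
  ultimately show ?thesis
    using f1 by (simp add: power2_eq_square algebra_simps diff_divide_distrib)
qed

section \<open>Summation over the iterations\<close>

text \<open>The merit function changes with the penalty parameter. Measuring the violation \<open>n\<close> by its
  defect from the bound \<open>C\<close> gives the potential \<open>F k - \<rho> k (C - n k)\<close>, which an increase of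
  \<open>\<rho>\<close> can only lower, so that the decreases for the different values of \<open>\<rho>\<close> telescope.\<close>

lemma sum_merit_decreases_le:
  fixes F n \<rho> a :: "nat \<Rightarrow> real"
  assumes dec: "\<And>k. F (Suc k) + \<rho> k * n (Suc k) \<le> F k + \<rho> k * n k - a k"
    and mono: "\<And>k. \<rho> k \<le> \<rho> (Suc k)" and "0 \<le> \<rho> 0" and le: "\<And>k. n k \<le> C"
  shows "(\<Sum>k<m. a k) \<le> F 0 - F m + \<rho> m * (C - n m)"
proof (induction m)
  case 0
  show ?case using \<open>0 \<le> \<rho> 0\<close> le[of 0] by simp
next
  case (Suc m)
  have "\<rho> m * (C - n (Suc m)) \<le> \<rho> (Suc m) * (C - n (Suc m))"
    using mono le[of "Suc m"] by (intro mult_right_mono) auto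
  with Suc dec[of m] show ?case by (simp add: algebra_simps)
qed

section \<open>The complexity bound\<close>

theorem theorem2:
  fixes f :: "real^'d \<Rightarrow> real"
    and c :: "real^'d \<Rightarrow> real^'m"
    and A :: "real^'d \<Rightarrow> real^'m^'m"
    and X :: "(real^'d) set"
    and x0 :: "real^'d"
    and x s :: "nat \<Rightarrow> real^'d"
    and \<rho> \<eta> :: "nat \<Rightarrow> real"
    and \<tau> \<rho>0 f_low C Lf Lgf Lc Lgc \<nu> \<beta> \<beta>bar \<delta> \<epsilon> \<rho>max \<eta>min K :: real
  assumes tau: "0 < \<tau>" "\<tau> < 1"
    and rho0: "0 < \<rho>0"
    and alg: "algorithm1 f c A x0 \<tau> \<rho>0 \<beta> Lgf Lgc x s \<rho> \<eta>"
    and A1_X: "open X" "convex X" "range x \<subseteq> X"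
    and A1_level_bounded: "\<And>a. bounded {y. f y \<le> a}"
    and A1_below: "\<And>y. f_low \<le> f y"
    and A1_c: "0 < C" "\<And>y. y \<in> X \<Longrightarrow> norm (c y) \<le> C"
    and A2_C1: "C1_fun f" "\<And>j. C1_fun (\<lambda>y. c y $ j)"
    and A2_pos: "0 < Lf" "0 < Lgf" "0 < Lc" "0 < Lgc"
    and A2_f: "\<And>y. y \<in> X \<Longrightarrow> norm (gradient f y) \<le> Lf"
      "\<And>y z. y \<in> X \<Longrightarrow> z \<in> X \<Longrightarrow>
         norm (gradient f y - gradient f z) \<le> Lgf * norm (y - z)"
    and A2_c: "\<And>y. y \<in> X \<Longrightarrow> opnorm (nabla c y) \<le> Lc"
      "\<And>y z. y \<in> X \<Longrightarrow> z \<in> X \<Longrightarrow>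
         opnorm (nabla c y - nabla c z) \<le> Lgc * norm (y - z)"
    and A3: "0 < \<nu>" "\<And>y \<sigma>. y \<in> X \<Longrightarrow> \<sigma> \<in> singular_values (nabla c y) \<Longrightarrow> \<nu> \<le> \<sigma>"
    and A4_sym: "\<And>y. y \<in> X \<Longrightarrow>
         transpose (transpose (nabla c y) ** nabla c y ** A y)
           = transpose (nabla c y) ** nabla c y ** A y"
    and A4_pos: "0 < \<beta>" "0 < \<beta>bar"
    and A4_bounds:
      "\<And>y. y \<in> X \<Longrightarrow> \<beta> \<le> lambda_min (transpose (nabla c y) ** nabla c y ** A y)"
      "\<And>y. y \<in> X \<Longrightarrow> opnorm (A y) \<le> \<beta>bar"
    and delta: "0 < \<delta>"
      "\<And>k \<sigma>. \<sigma> \<in> singular_values (nabla c (x k) ** A (x k)) \<Longrightarrow> \<delta> < \<sigma>"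
    and eps: "0 < \<epsilon>" "\<epsilon> < 1"
    and rho_max: "\<rho>max = max ((Lc\<^sup>2 * C * \<beta>bar\<^sup>2 + Lf * Lc * \<beta>bar) / \<beta>) \<rho>0"
    and eta_min: "\<eta>min = min (\<tau> / (Lgf + \<rho>max * Lgc)) (1 / (Lc\<^sup>2 * \<beta>bar))"
    and K: "K = 2 * inverse (1 - \<tau>)
              * ((f x0 - f_low + \<rho>max * C) / (\<eta>min * min (\<delta>\<^sup>2) 1)) * inverse (\<epsilon>\<^sup>2)"
  shows "\<exists>k. real k < K \<and> eps_KKT \<epsilon> f c (x k)"
proof -
  define N where "N k = nabla c (x k)" for k
  define g where "g k = gradient f (x k)" for k
  define w where "w k = A (x k) *v c (x k)" for k
  define p where "p k = orth_proj {v. transpose (N k) *v v = 0} (g k)" for k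
  define n where "n k = norm (c (x k))" for k
  define M where "M k = transpose (N k) ** N k ** A (x k)" for k
  define \<rho>' where "\<rho>' k = (if k = 0 then \<rho>0 else \<rho> (k - 1))" for k

  have x0: "x 0 = x0" and s: "s k = - p k - N k *v w k"
    and \<rho>: "\<rho> k = (if c (x k) \<noteq> 0
      then max ((g k \<bullet> s k + (1/2) * (norm (s k))\<^sup>2) / (\<beta> * n k)) (\<rho>' k) else \<rho>' k)"
    and \<eta>: "\<eta> k = min (\<tau> / (Lgf + \<rho> k * Lgc)) (1 / opnorm (M k))"
    and step: "x (Suc k) = x k + \<eta> k *\<^sub>R s k" for k
    using alg unfolding algorithm1_def Let_def N_def g_def w_def p_def n_def M_def \<rho>'_def
    by blast+
  have X: "x k \<in> X" for k
    using A1_X(3) by blast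
  have n: "0 \<le> n k" "n k \<le> C" for k
    using A1_c(2)[OF X] by (auto simp: n_def)

  obtain \<mu> where p: "\<And>k. p k = g k + N k *v \<mu> k" and ker: "\<And>k. transpose (N k) *v p k = 0"
  proof -
    have "\<exists>\<mu>. p k = g k + N k *v \<mu> \<and> transpose (N k) *v p k = 0" for k
    proof -
      have "invertible (transpose (N k) ** N k)"
        unfolding N_def by (rule invertible_Gram_matrix[OF A3(1)]) (rule A3(2)[OF X])
      from kernel_projection_decomposition[OF this, of "g k"] show ?thesis
        unfolding p_def by metis
    qed
    then show thesis using that by metis
  qed
  note geom = tangential_normal_step[OF s p ker]

  have Nw: "norm (N k *v w k) \<le> Lc * \<beta>bar * n k" for k
  proof -
    have "norm (N k *v w k) \<le> opnorm (N k) * (opnorm (A (x k)) * n k)"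
      unfolding w_def n_def
      by (meson norm_matrix_vector_le opnorm_nonneg mult_left_mono order_trans)
    also have "\<dots> \<le> Lc * (\<beta>bar * n k)"
      using A2_c(1)[OF X] A4_bounds(2)[OF X] A2_pos A4_pos n
      by (intro mult_mono) (auto simp: N_def opnorm_nonneg)
    finally show ?thesis by simp
  qed

  \<comment> \<open>This bounds the quotient in the penalty rule: the terms of the numerator in \<open>N w\<close> carry
    a factor \<open>n\<close>, and in the quadratic one a second factor \<open>n\<close> is estimated by \<open>C\<close>.\<close>
  have penalty_ratio: "g k \<bullet> s k + (1/2) * (norm (s k))\<^sup>2 \<le> \<rho>max * (\<beta> * n k)" for k
  proof -
    let ?b = "Lc * \<beta>bar"
    have b: "0 \<le> ?b" using A2_pos A4_pos by simp
    have "- (g k \<bullet> (N k *v w k)) \<le> norm (g k) * norm (N k *v w k)"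
      using Cauchy_Schwarz_ineq2[of "g k" "N k *v w k"] by simp
    also have "\<dots> \<le> Lf * (?b * n k)"
      using A2_f(1)[OF X] Nw A2_pos by (intro mult_mono) (auto simp: g_def)
    finally have 1: "- (g k \<bullet> (N k *v w k)) \<le> Lf * (?b * n k)" .
    have "(norm (N k *v w k))\<^sup>2 \<le> (?b * n k)\<^sup>2"
      using Nw by (intro power_mono) auto
    also have "\<dots> = ?b\<^sup>2 * (n k * n k)"
      by (simp add: power2_eq_square mult_ac)
    also have "\<dots> \<le> ?b\<^sup>2 * (C * n k)"
      using n[of k] by (intro mult_left_mono mult_right_mono) auto
    finally have 2: "(norm (N k *v w k))\<^sup>2 \<le> ?b\<^sup>2 * C * n k" by (simp add: mult.assoc)
    have "0 \<le> ?b\<^sup>2 * C * n k" "0 \<le> (norm (p k))\<^sup>2"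
      using n A1_c(1) by auto
    then have "g k \<bullet> s k + (1/2) * (norm (s k))\<^sup>2 \<le> ?b\<^sup>2 * C * n k + Lf * (?b * n k)"
      using 1 2 geom(1,2)[of k] by linarith
    also have "\<dots> = (Lc\<^sup>2 * C * \<beta>bar\<^sup>2 + Lf * Lc * \<beta>bar) / \<beta> * (\<beta> * n k)"
      using A4_pos by (simp add: power2_eq_square field_simps)
    also have "\<dots> \<le> \<rho>max * (\<beta> * n k)"
      using n A4_pos unfolding rho_max by (intro mult_right_mono) auto
    finally show ?thesis .
  qed

  have \<rho>'_le: "\<rho>' k \<le> \<rho> k" for k
    by (simp add: \<rho>)
  have \<rho>_le: "\<rho> k \<le> max \<rho>max (\<rho>' k)" for k
  proof (cases "c (x k) = 0")
    case False
    then have "0 < \<beta> * n k" using A4_pos by (simp add: n_def)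
    then have "(g k \<bullet> s k + (1/2) * (norm (s k))\<^sup>2) / (\<beta> * n k) \<le> \<rho>max"
      using penalty_ratio[of k] by (simp add: divide_le_eq)
    then show ?thesis by (auto simp: \<rho>)
  qed (simp add: \<rho>)
  have \<rho>_bounds: "0 < \<rho> k \<and> \<rho> k \<le> \<rho>max" for k
  proof (induction k)
    case 0
    show ?case
      using \<rho>'_le[of 0] \<rho>_le[of 0] rho0 rho_max by (auto simp: \<rho>'_def)
  next
    case (Suc k)
    then show ?case
      using \<rho>'_le[of "Suc k"] \<rho>_le[of "Suc k"] by (auto simp: \<rho>'_def)
  qed
  have \<rho>_mono: "\<rho> k \<le> \<rho> (Suc k)" for k
    using \<rho>'_le[of "Suc k"] by (simp add: \<rho>'_def)

  have sym: "transpose (M k) = M k" for k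
    unfolding M_def N_def by (rule A4_sym[OF X])
  have form: "\<beta> * (norm v)\<^sup>2 \<le> v \<bullet> (M k *v v)" for k v
  proof -
    have "\<beta> * (norm v)\<^sup>2 \<le> lambda_min (M k) * (norm v)\<^sup>2"
      using A4_bounds(1)[OF X] by (intro mult_right_mono) (auto simp: M_def N_def)
    also have "\<dots> \<le> v \<bullet> (M k *v v)"
      by (rule lambda_min_form_le[OF sym])
    finally show ?thesis .
  qed
  \<comment> \<open>Positivity matters because \<open>1 / 0 = 0\<close> would make the step size vanish.\<close>
  have opM: "0 < opnorm (M k)" "opnorm (M k) \<le> Lc\<^sup>2 * \<beta>bar" for k
  proof -
    define e :: "real^'m" where "e = axis undefined 1"
    have "norm e = 1" by (simp add: e_def)
    then have "\<beta> \<le> e \<bullet> (M k *v e)" using form[of e k] by simp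
    also have "\<dots> \<le> norm e * (opnorm (M k) * norm e)"
      by (meson norm_cauchy_schwarz norm_matrix_vector_le mult_left_mono norm_ge_zero order_trans)
    finally show "0 < opnorm (M k)" using \<open>norm e = 1\<close> A4_pos by simp
    have "opnorm (M k) \<le> (opnorm (transpose (N k)) * opnorm (N k)) * opnorm (A (x k))"
      unfolding M_def by (meson opnorm_mult_le opnorm_nonneg mult_right_mono order_trans)
    also have "\<dots> \<le> (Lc * Lc) * \<beta>bar"
      using order_trans[OF opnorm_transpose_le A2_c(1)[OF X]] A2_c(1)[OF X] A4_bounds(2)[OF X] A2_pos
      by (intro mult_mono) (auto simp: N_def opnorm_nonneg)
    finally show "opnorm (M k) \<le> Lc\<^sup>2 * \<beta>bar" by (simp add: power2_eq_square)
  qed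

  have den: "0 < Lgf + r * Lgc" if "0 < r" for r
    using A2_pos that by (simp add: add_pos_pos)
  have \<rho>max_pos: "0 < \<rho>max"
    using \<rho>_bounds[of 0] by linarith
  have \<eta>min_pos: "0 < \<eta>min"
    using tau den[OF \<rho>max_pos] A2_pos A4_pos by (simp add: eta_min)
  have \<eta>_ge: "\<eta>min \<le> \<eta> k" for k
  proof -
    have "\<tau> / (Lgf + \<rho>max * Lgc) \<le> \<tau> / (Lgf + \<rho> k * Lgc)"
      using \<rho>_bounds[of k] A2_pos tau den by (intro divide_left_mono) auto
    moreover have "1 / (Lc\<^sup>2 * \<beta>bar) \<le> 1 / opnorm (M k)"
      using opM[of k] A2_pos A4_pos by (intro divide_left_mono) auto
    ultimately show ?thesis unfolding \<eta> eta_min by auto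
  qed
  have \<eta>_pos: "0 < \<eta> k" for k
    using \<eta>_ge[of k] \<eta>min_pos by linarith
  have \<eta>_Lip: "\<eta> k * (Lgf + \<rho> k * Lgc) \<le> \<tau>" for k
    using \<eta>[of k] den[of "\<rho> k"] \<rho>_bounds[of k] by (simp add: pos_le_divide_eq[symmetric])
  have \<eta>_op: "\<eta> k * opnorm (M k) \<le> 1" for k
    using \<eta>[of k] opM[of k] by (simp add: pos_le_divide_eq[symmetric])

  have objective: "f (x (Suc k))
      \<le> f (x k) + \<eta> k * (g k \<bullet> s k) + Lgf / 2 * ((\<eta> k)\<^sup>2 * (norm (s k))\<^sup>2)" for k
  proof -
    have "norm (f (x k + \<eta> k *\<^sub>R s k) - f (x k) - (\<eta> k *\<^sub>R s k) \<bullet> gradient f (x k))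
        \<le> Lgf / 2 * (norm (\<eta> k *\<^sub>R s k))\<^sup>2"
    proof (rule linearisation_error_le[OF A1_X(2) X])
      show "x k + \<eta> k *\<^sub>R s k \<in> X" using X[of "Suc k"] by (simp add: step)
      fix z assume z: "z \<in> X"
      show "(f has_derivative (\<lambda>h. h \<bullet> gradient f z)) (at z)"
        using GDERIV_gradient[of f z] A2_C1(1) by (simp add: C1_fun_def gderiv_def)
      let ?h = "\<eta> k *\<^sub>R s k"
      have "norm (?h \<bullet> gradient f z - ?h \<bullet> gradient f (x k))
          \<le> norm ?h * norm (gradient f z - gradient f (x k))"
        using Cauchy_Schwarz_ineq2[of ?h "gradient f z - gradient f (x k)"]
        by (simp add: inner_diff_right)
      also have "\<dots> \<le> norm ?h * (Lgf * norm (z - x k))"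
        by (intro mult_left_mono A2_f(2) z X) auto
      finally show "norm (?h \<bullet> gradient f z - ?h \<bullet> gradient f (x k))
          \<le> Lgf * norm (z - x k) * norm ?h"
        by (simp add: mult_ac)
    qed
    then have "f (x k + \<eta> k *\<^sub>R s k) - f (x k) - (\<eta> k *\<^sub>R s k) \<bullet> gradient f (x k)
        \<le> Lgf / 2 * (norm (\<eta> k *\<^sub>R s k))\<^sup>2"
      unfolding real_norm_def by linarith
    then show ?thesis
      by (simp add: step g_def inner_commute power_mult_distrib)
  qed

  have violation: "n (Suc k)
      \<le> (1 - \<eta> k * \<beta>) * n k + Lgc / 2 * ((\<eta> k)\<^sup>2 * (norm (s k))\<^sup>2)" for k
  proof -
    let ?h = "\<eta> k *\<^sub>R s k"
    let ?E = "c (x k + ?h) - c (x k) - transpose (nabla c (x k)) *v ?h"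
    have err: "norm ?E \<le> Lgc / 2 * (norm ?h)\<^sup>2"
    proof (rule linearisation_error_le[OF A1_X(2) X])
      show "x k + ?h \<in> X" using X[of "Suc k"] by (simp add: step)
      fix z assume z: "z \<in> X"
      show "(c has_derivative (\<lambda>h. transpose (nabla c z) *v h)) (at z)"
        using A2_C1(2) by (intro has_derivative_nabla) (simp add: C1_fun_def)
      have "transpose (nabla c z) *v ?h - transpose (nabla c (x k)) *v ?h
          = transpose (nabla c z - nabla c (x k)) *v ?h"
        by (simp add: vec_eq_iff matrix_vector_mult_def transpose_def sum_subtractf left_diff_distrib
            del: transpose_matrix_vector)
      then have "norm (transpose (nabla c z) *v ?h - transpose (nabla c (x k)) *v ?h)
          \<le> opnorm (nabla c z - nabla c (x k)) * norm ?h"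
        by (metis norm_transpose_matrix_vector_le)
      also have "\<dots> \<le> Lgc * norm (z - x k) * norm ?h"
        by (intro mult_right_mono A2_c(2) z X) auto
      finally show "norm (transpose (nabla c z) *v ?h - transpose (nabla c (x k)) *v ?h)
          \<le> Lgc * norm (z - x k) * norm ?h" .
    qed
    have "transpose (nabla c (x k)) *v ?h = - (\<eta> k *\<^sub>R (M k *v c (x k)))"
      using geom(3)[of k]
      by (simp add: N_def w_def M_def matrix_vector_mult_scaleR matrix_vector_mul_assoc
          del: transpose_matrix_vector)
    then have "c (x (Suc k)) = ?E + (c (x k) - \<eta> k *\<^sub>R (M k *v c (x k)))"
      by (simp add: step)
    then have "n (Suc k) \<le> norm ?E + norm (c (x k) - \<eta> k *\<^sub>R (M k *v c (x k)))"
      unfolding n_def by (metis norm_triangle_ineq)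
    also have "\<dots> \<le> Lgc / 2 * (norm ?h)\<^sup>2 + (1 - \<eta> k * \<beta>) * n k"
      unfolding n_def using \<eta>_pos[of k]
      by (intro add_mono err norm_symmetric_step_le sym form \<eta>_op) simp
    finally show ?thesis by (simp add: power_mult_distrib)
  qed

  \<comment> \<open>For \<open>c = 0\<close> the step is purely tangential, so that the left-hand side is \<open>- \<parallel>p\<parallel>\<^sup>2 / 2\<close>.\<close>
  have penalty: "g k \<bullet> s k + (norm (s k))\<^sup>2 / 2 \<le> \<rho> k * \<beta> * n k" for k
  proof (cases "c (x k) = 0")
    case True
    then have "N k *v w k = 0" by (simp add: w_def)
    with True geom(1,2)[of k] show ?thesis by (simp add: n_def)
  next
    case False
    then have "0 < \<beta> * n k" using A4_pos by (simp add: n_def)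
    moreover have "(g k \<bullet> s k + (1/2) * (norm (s k))\<^sup>2) / (\<beta> * n k) \<le> \<rho> k"
      using False by (simp add: \<rho>[of k])
    ultimately show ?thesis by (simp add: divide_le_eq mult_ac)
  qed

  define D where "D = f x0 - f_low + \<rho>max * C"
  have total: "(\<Sum>k<m. (1 - \<tau>) / 2 * (\<eta> k * (norm (s k))\<^sup>2)) \<le> D" for m
  proof -
    have "f (x (Suc k)) + \<rho> k * n (Suc k)
        \<le> f (x k) + \<rho> k * n k - (1 - \<tau>) / 2 * (\<eta> k * (norm (s k))\<^sup>2)" for k
      using \<eta>_pos[of k] \<rho>_bounds[of k]
      by (intro merit_decrease[OF objective violation penalty _ \<eta>_Lip]) auto
    from sum_merit_decreases_le[where F = "\<lambda>k. f (x k)", OF this \<rho>_mono _ n(2), of m]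
    have "(\<Sum>k<m. (1 - \<tau>) / 2 * (\<eta> k * (norm (s k))\<^sup>2))
        \<le> f (x 0) - f (x m) + \<rho> m * (C - n m)"
      using \<rho>_bounds[of 0] by simp
    also have "\<rho> m * (C - n m) \<le> \<rho>max * C"
      using \<rho>_bounds[of m] n[of m] by (intro mult_mono) auto
    finally show ?thesis
      using A1_below[of "x m"] by (simp add: D_def x0)
  qed

  \<comment> \<open>A lower bound for the merit decrease at an iterate that is not an \<open>\<epsilon>\<close>-KKT point, so that
    \<open>K = D / q\<close>.\<close>
  define q where "q = (1 - \<tau>) / 2 * (\<eta>min * (min (\<delta>\<^sup>2) 1 * \<epsilon>\<^sup>2))"
  have q_pos: "0 < q"
    using tau \<eta>min_pos delta(1) eps by (simp add: q_def)
  have large: "q < (1 - \<tau>) / 2 * (\<eta> k * (norm (s k))\<^sup>2)" if "\<not> eps_KKT \<epsilon> f c (x k)" for k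
  proof -
    let ?d = "min (\<delta>\<^sup>2) 1"
    have d: "0 < ?d" "?d \<le> \<delta>\<^sup>2" "?d \<le> 1" using delta(1) by auto
    have "\<delta> * n k \<le> norm ((N k ** A (x k)) *v c (x k))"
      unfolding n_def N_def using delta
      by (intro norm_ge_singular_value_bound) (auto intro: less_imp_le)
    then have "\<delta> * n k \<le> norm (N k *v w k)"
      by (simp add: w_def matrix_vector_mul_assoc)
    then have "\<delta>\<^sup>2 * (n k)\<^sup>2 \<le> (norm (N k *v w k))\<^sup>2"
      using delta(1) n[of k] by (metis power_mono power_mult_distrib mult_nonneg_nonneg less_imp_le)
    moreover have "?d * (n k)\<^sup>2 \<le> \<delta>\<^sup>2 * (n k)\<^sup>2" "?d * (norm (p k))\<^sup>2 \<le> 1 * (norm (p k))\<^sup>2"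
      by (intro mult_right_mono d; simp)+
    ultimately have "?d * ((norm (p k))\<^sup>2 + (n k)\<^sup>2) \<le> (norm (s k))\<^sup>2"
      using geom(1)[of k] by (simp add: distrib_left)
    moreover have "\<epsilon>\<^sup>2 < (norm (p k))\<^sup>2 + (n k)\<^sup>2"
    proof -
      have "\<epsilon> < norm (p k) \<or> \<epsilon> < n k"
        \<comment> \<open>The multiplier of the projection serves as the KKT multiplier.\<close>
        using that p[of k] unfolding eps_KKT_def n_def g_def N_def by (metis not_less)
      then have "\<epsilon>\<^sup>2 < (norm (p k))\<^sup>2 \<or> \<epsilon>\<^sup>2 < (n k)\<^sup>2"
        using eps by (auto intro: power_strict_mono)
      then show ?thesis
        using zero_le_power2[of "norm (p k)"] zero_le_power2[of "n k"] by linarith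
    qed
    ultimately have "?d * \<epsilon>\<^sup>2 < (norm (s k))\<^sup>2"
      using d(1) by (meson mult_strict_left_mono order_less_le_trans)
    then have "\<eta>min * (?d * \<epsilon>\<^sup>2) < \<eta> k * (norm (s k))\<^sup>2"
      using \<eta>_ge[of k] \<eta>min_pos d(1)
      by (intro mult_le_less_imp_less) auto
    then show ?thesis
      unfolding q_def using tau by (intro mult_strict_left_mono) auto
  qed

  have "0 < D"
    using A1_below[of x0] mult_pos_pos[OF \<rho>max_pos A1_c(1)] by (simp add: D_def)
  have K_eq: "K = D / q"
    unfolding K D_def[symmetric] q_def using tau by (simp add: divide_simps)
  show ?thesis
  proof (rule ccontr)
    assume none: "\<nexists>k. real k < K \<and> eps_KKT \<epsilon> f c (x k)"
    \<comment> \<open>The first \<open>m\<close> iterates are those with index below \<open>K\<close>; their decreases add up to more than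
      \<open>m q \<ge> D\<close>, strictly because \<open>m > 0\<close>.\<close>
    define m where "m = nat \<lceil>K\<rceil>"
    have "0 < K" using \<open>0 < D\<close> q_pos by (simp add: K_eq)
    then have "0 < m" and "K \<le> m" and before: "\<And>k. k < m \<Longrightarrow> real k < K"
      unfolding m_def by linarith+
    have "D \<le> m * q"
      using \<open>K \<le> m\<close> q_pos by (simp add: K_eq divide_le_eq)
    also have "\<dots> = (\<Sum>k<m. q)" by simp
    also have "\<dots> < (\<Sum>k<m. (1 - \<tau>) / 2 * (\<eta> k * (norm (s k))\<^sup>2))"
      using \<open>0 < m\<close> none before by (intro sum_strict_mono large) auto
    also have "\<dots> \<le> D" by (rule total)
    finally show False by simp
  qed
qed

end
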